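(* Let $\alpha\in[0,\pi/2)$, $\sigma\in(0,1]$, $R_0>0$. Let $(\tau_\epsilon)_{\epsilon\in[0,1]}$ be a continuous family of complex numbers with $|\tau_\epsilon|\ge 1$, with $\tau_\epsilon=1$ if and only if $\epsilon=0$, and with $\tau_\epsilon\to1$ $\alpha$-radially as $\epsilon\to0$. Let $\{f_\epsilon:\epsilon\in[0,1]\}$ be a family of holomorphic maps on $\mathbb{B}(R_0)=\{z\in\mathbb{C}:|z|\ge R_0\}$ of the form $$f_\epsilon(z)=\tau_\epsilon z+1+O(1/|z|^\sigma),\qquad f_0(z)=z+1+O(1/|z|^\sigma),$$ where the constants in the $O$-terms are uniform in $\epsilon\in[0,1]$, and suppose that $f_\epsilon\to f_0$ uniformly on compact sets as $\epsilon\to0$. Then for every sufficiently large $R$ (independently of $\epsilon$) the following hold: (1) For any $\epsilon\in[0,1]$ there exists a holomorphic map $u_\epsilon:\mathbb{V}_\epsilon(R)\to\mathbb{C}$ such that $$u_\epsilon(f_\epsilon(z))=\tau_\epsilon u_\epsilon(z)+1\qquad (z\in\mathbb{V}_\epsilon(R)).$$ (2) These maps $u_\epsilon$ can be taken such that for any compact set $K$ contained in $\mathbb{V}_\epsilon(R)$ for all $\epsilon\in[0,1]$, $u_\epsilon\to u_0$ uniformly on $K$ as $\epsilon\to0$.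
   Context: A variable $\tau\in\mathbb{C}$ converges to $1$ $\alpha$-radially if $\tau\to1$ and $|\arg(\tau-1)|\le\alpha$ (whenever $\tau\ne1$), for the fixed $\alpha\in[0,\pi/2)$. For $\epsilon\in(0,1]$ set $b_\epsilon:=1/(1-\tau_\epsilon)$ and $N_\epsilon(z):=|z-b_\epsilon|-|b_\epsilon|$. For $\epsilon=0$ set $N_0(z):=\sup\{\mathrm{Re}(e^{i\theta}z):|\theta|\le\alpha\}$. For $R>0$ and $\epsilon\in[0,1]$ set $$\mathbb{V}_\epsilon(R):=\{z\in\mathbb{C}:N_\epsilon(z)\ge R\}.$$ One has $N_\epsilon(z)\le|z|$, so $\mathbb{V}_\epsilon(R)\subset\mathbb{B}(R):=\{z\in\mathbb{C}:|z|\ge R\}$. A map on a closed set is called holomorphic if it extends holomorphically to a neighborhood of that set. *)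

theory Defs
  imports "HOL-Complex_Analysis.Complex_Analysis" "HOL-Library.Landau_Symbols"
begin

text \<open>
  Holomorphy of a map on a (typically closed) set \<open>S\<close>: it extends holomorphically to an open
  neighbourhood of \<open>S\<close>. The extension \<open>g\<close> is separate from \<open>f\<close> so that the values
  of the total function \<open>f\<close> outside \<open>S\<close> are irrelevant.
\<close>
definition holomorphic_near :: "(complex \<Rightarrow> complex) \<Rightarrow> complex set \<Rightarrow> bool" where
  "holomorphic_near f S \<longleftrightarrow>
     (\<exists>U g. open U \<and> S \<subseteq> U \<and> g holomorphic_on U \<and> (\<forall>z\<in>S. g z = f z))"

text \<open>
  The bound on the argument is imposed on the whole parameter range \<open>{0..1}\<close>, not just for
  parameters close to \<open>0\<close>.
\<close>
definition radially_tends_to_1 :: "real \<Rightarrow> (real \<Rightarrow> complex) \<Rightarrow> bool" where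
  "radially_tends_to_1 \<alpha> \<tau> \<longleftrightarrow>
     (\<tau> \<longlongrightarrow> 1) (at 0 within {0..1}) \<and>
     (\<forall>\<epsilon>\<in>{0..1}. \<tau> \<epsilon> \<noteq> 1 \<longrightarrow> \<bar>Arg (\<tau> \<epsilon> - 1)\<bar> \<le> \<alpha>)"

definition b :: "(real \<Rightarrow> complex) \<Rightarrow> real \<Rightarrow> complex" where
  "b \<tau> \<epsilon> = 1 / (1 - \<tau> \<epsilon>)"

definition N :: "real \<Rightarrow> (real \<Rightarrow> complex) \<Rightarrow> real \<Rightarrow> complex \<Rightarrow> real" where
  "N \<alpha> \<tau> \<epsilon> z =
     (if \<epsilon> = 0 then (SUP \<theta>\<in>{\<theta>. \<bar>\<theta>\<bar> \<le> \<alpha>}. Re (exp (\<i> * of_real \<theta>) * z))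
      else norm (z - b \<tau> \<epsilon>) - norm (b \<tau> \<epsilon>))"

definition \<V> :: "real \<Rightarrow> (real \<Rightarrow> complex) \<Rightarrow> real \<Rightarrow> real \<Rightarrow> complex set" where
  "\<V> \<alpha> \<tau> \<epsilon> R = {z. N \<alpha> \<tau> \<epsilon> z \<ge> R}"

definition \<B> :: "real \<Rightarrow> complex set" where
  "\<B> R = {z. norm z \<ge> R}"

text \<open>
  \<open>f\<^sub>\<epsilon>(z) = \<tau>\<^sub>\<epsilon> z + 1 + O(1/|z|\<^sup>\<sigma>)\<close> as \<open>z \<rightarrow> \<infinity>\<close>, uniformly in
  \<open>\<epsilon>\<close>: membership with respect to this product filter means that one constant and one
  threshold on \<open>|z|\<close> work for all \<open>\<epsilon>\<close> in \<open>{0..1}\<close>. For \<open>\<epsilon> = 0\<close> and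
  \<open>\<tau>\<^sub>0 = 1\<close> it reads \<open>f\<^sub>0(z) = z + 1 + O(1/|z|\<^sup>\<sigma>)\<close>.
\<close>
definition uniform_expansion ::
    "real \<Rightarrow> (real \<Rightarrow> complex) \<Rightarrow> (real \<Rightarrow> complex \<Rightarrow> complex) \<Rightarrow> bool" where
  "uniform_expansion \<sigma> \<tau> f \<longleftrightarrow>
     (\<lambda>(\<epsilon>, z). f \<epsilon> z - (\<tau> \<epsilon> * z + 1))
       \<in> O[principal {0..1} \<times>\<^sub>F at_infinity](\<lambda>(\<epsilon>, z). of_real (1 / norm z powr \<sigma>))"

end

theory Submission imports Defs begin

text \<open>
  Write \<open>f = f\<^sub>\<epsilon>\<close>, \<open>\<tau> = \<tau>\<^sub>\<epsilon>\<close> and \<open>g(z) = f(z) - \<tau>z - 1\<close>. The obvious candidate for the solution,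
  \<open>lim\<^sub>n A\<^sup>-\<^sup>n(f\<^sup>n(z))\<close> with \<open>A(z) = \<tau>z + 1\<close>, adds up the terms \<open>\<tau>\<^sup>-\<^sup>n\<^sup>-\<^sup>1 g(f\<^sup>n(z))\<close>. These need not
  be summable at \<open>\<epsilon> = 0\<close>, where \<open>\<tau> = 1\<close> and \<open>g(f\<^sup>n(z))\<close> may decay only like \<open>1/n\<close>. The remedy is to
  compare two orbits. Fix a base point \<open>a\<close> and put
  \<open>d\<^sub>n(z) = (f\<^sup>n(z) - f\<^sup>n(a)) / \<tau>\<^sup>n\<close>. Its increments are
  \<open>\<tau>\<^sup>-\<^sup>n\<^sup>-\<^sup>1 (g(f\<^sup>n(z)) - g(f\<^sup>n(a)))\<close>.

  The perturbation \<open>g\<close> is holomorphic near infinity and vanishes there, so \<open>s \<mapsto> g(1/s)\<close>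
  extends holomorphically over \<open>0\<close>. For every exponent \<open>\<sigma>\<close> this gives
  \<open>|g(z)| \<le> L/|z|\<close> and \<open>|g(z) - g(w)| \<le> L|z - w|/(|z||w|)\<close>, with \<open>L\<close> independent of \<open>\<epsilon>\<close>
  (\<open>exterior_lipschitz\<close>). The height \<open>N\<^sub>\<epsilon>\<close> grows by at least \<open>c = cos(\<alpha>)/2\<close> in each step
  (\<open>N_affine_step\<close>) and is bounded by the modulus, so orbits that start at height \<open>S\<close> satisfy
  \<open>|f\<^sup>n(z)| \<ge> S + cn\<close>. Hence
  \<open>|d\<^sub>n\<^sub>+\<^sub>1 - d\<^sub>n| \<le> L |d\<^sub>n| / (S + cn)\<^sup>2\<close>: the relative increments are summable, with a sum
  that is small for large \<open>S\<close>, uniformly in \<open>\<epsilon>\<close>. Therefore \<open>d\<^sub>n\<close> converges to a limit \<open>\<phi>\<close>,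
  locally uniformly in \<open>z\<close> and uniformly in \<open>\<epsilon>\<close>, and \<open>\<phi>(z)\<close> differs from \<open>z - a\<close> by at most half
  of \<open>|z - a|\<close>; in particular \<open>\<phi>\<close> vanishes only at \<open>a\<close>.

  Passing to the limit in \<open>d\<^sub>n(f(z)) = \<tau> d\<^sub>n\<^sub>+\<^sub>1(z) + d\<^sub>n(f(a))\<close> gives
  \<open>\<phi>(f(z)) = \<tau> \<phi>(z) + \<phi>(f(a))\<close>. As \<open>f(a)\<close> is higher than \<open>a\<close>, the constant \<open>\<phi>(f(a))\<close> is not zero,
  and \<open>u = \<phi> / \<phi>(f(a))\<close> is the required solution. For each fixed \<open>n\<close> the function \<open>d\<^sub>n\<close> depends
  continuously on \<open>\<epsilon>\<close> at \<open>0\<close>, uniformly on compact sets; since \<open>d\<^sub>n \<rightarrow> \<phi>\<close> uniformly in \<open>\<epsilon>\<close>,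
  the same is true of \<open>\<phi>\<close> and hence of \<open>u\<close>.
\<close>

section \<open>Sequences whose relative increments are summable\<close>

text \<open>
  The increments are weighted by the differences of a decreasing null sequence \<open>\<rho>\<close>, so their
  sums telescope to explicit tail bounds. The threshold \<open>1/4\<close> closes the induction: while
  \<open>|d\<^sub>k| \<le> 2|d\<^sub>0|\<close> holds for \<open>k < n\<close>, the total displacement is at most \<open>2|d\<^sub>0|/4\<close>, and the bound
  \<open>2|d\<^sub>0|\<close> persists. The remaining slack makes the limit nonzero as soon as \<open>d\<^sub>0 \<noteq> 0\<close>.
\<close>
lemma small_relative_increments:
  fixes d :: "nat \<Rightarrow> complex" and \<rho> :: "nat \<Rightarrow> real"
  assumes inc: "\<And>n. norm (d (Suc n) - d n) \<le> (\<rho> n - \<rho> (Suc n)) * norm (d n)"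
    and anti: "\<And>n. \<rho> (Suc n) \<le> \<rho> n" and nonneg: "\<And>n. 0 \<le> \<rho> n"
    and small: "\<rho> 0 \<le> 1 / 4" and lim: "\<rho> \<longlonglongrightarrow> 0"
  shows "convergent d" and "norm (lim d - d n) \<le> 2 * norm (d 0) * \<rho> n"
proof -
  have bounded_if_close: "norm (d n) \<le> 2 * norm (d 0)"
    if "norm (d n - d 0) \<le> 2 * norm (d 0) * (\<rho> 0 - \<rho> n)" for n
  proof -
    have "2 * norm (d 0) * (\<rho> 0 - \<rho> n) \<le> 2 * norm (d 0) * (1/4)"
      using small nonneg[of n] by (intro mult_left_mono) auto
    moreover have "norm (d n) \<le> norm (d n - d 0) + norm (d 0)"
      using norm_triangle_sub[of "d n" "d 0"] by simp
    ultimately show ?thesis using that norm_ge_zero[of "d 0"] by linarith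
  qed
  have close: "norm (d n - d 0) \<le> 2 * norm (d 0) * (\<rho> 0 - \<rho> n)" for n
  proof (induction n)
    case (Suc n)
    have "(\<rho> n - \<rho> (Suc n)) * norm (d n) \<le> (\<rho> n - \<rho> (Suc n)) * (2 * norm (d 0))"
      using anti[of n] bounded_if_close[OF Suc] by (intro mult_left_mono) auto
    moreover have "norm (d (Suc n) - d 0) \<le> norm (d (Suc n) - d n) + norm (d n - d 0)"
      using norm_triangle_ineq[of "d (Suc n) - d n" "d n - d 0"] by simp
    ultimately have "norm (d (Suc n) - d 0)
        \<le> (\<rho> n - \<rho> (Suc n)) * (2 * norm (d 0)) + 2 * norm (d 0) * (\<rho> 0 - \<rho> n)"
      using Suc inc[of n] by linarith
    thus ?case by (simp add: algebra_simps)
  qed simp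
  note bounded = bounded_if_close[OF close]
  have tail: "norm (d (n + k) - d n) \<le> 2 * norm (d 0) * (\<rho> n - \<rho> (n + k))" for n k
  proof (induction k)
    case (Suc k)
    have "(\<rho> (n+k) - \<rho> (Suc (n+k))) * norm (d (n+k))
        \<le> (\<rho> (n+k) - \<rho> (Suc (n+k))) * (2 * norm (d 0))"
      using anti[of "n+k"] bounded[of "n+k"] by (intro mult_left_mono) auto
    moreover have "norm (d (Suc (n+k)) - d n) \<le> norm (d (Suc (n+k)) - d (n+k)) + norm (d (n+k) - d n)"
      using norm_triangle_ineq[of "d (Suc (n+k)) - d (n+k)" "d (n+k) - d n"] by simp
    ultimately have "norm (d (Suc (n+k)) - d n)
        \<le> (\<rho> (n+k) - \<rho> (Suc (n+k))) * (2 * norm (d 0)) + 2 * norm (d 0) * (\<rho> n - \<rho> (n+k))"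
      using Suc inc[of "n+k"] by linarith
    thus ?case by (simp add: algebra_simps)
  qed simp
  have tail': "norm (d m - d n) \<le> 2 * norm (d 0) * \<rho> n" if "n \<le> m" for n m
  proof -
    have "2 * norm (d 0) * (\<rho> n - \<rho> m) \<le> 2 * norm (d 0) * \<rho> n"
      using nonneg[of m] by (intro mult_left_mono) auto
    thus ?thesis using tail[of n "m - n"] that by simp
  qed
  have "Cauchy d"
  proof (rule CauchyI')
    fix e :: real assume "e > 0"
    have "(\<lambda>n. 2 * norm (d 0) * \<rho> n) \<longlonglongrightarrow> 2 * norm (d 0) * 0"
      by (intro tendsto_intros lim)
    hence "\<forall>\<^sub>F n in sequentially. 2 * norm (d 0) * \<rho> n < e"
      using \<open>e > 0\<close> by (intro order_tendstoD) auto
    then obtain M where M: "\<And>n. n \<ge> M \<Longrightarrow> 2 * norm (d 0) * \<rho> n < e"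
      by (auto simp: eventually_sequentially)
    show "\<exists>M. \<forall>m\<ge>M. \<forall>n>m. dist (d m) (d n) < e"
    proof (intro exI[of _ M] allI impI)
      fix m n assume "m \<ge> M" "n > m"
      thus "dist (d m) (d n) < e"
        using M[of m] tail'[of m n] by (simp add: dist_norm norm_minus_commute)
    qed
  qed
  thus conv: "convergent d" by (rule Cauchy_convergent)
  have "(\<lambda>m. norm (d m - d n)) \<longlonglongrightarrow> norm (lim d - d n)"
    using conv by (intro tendsto_intros) (simp add: convergent_LIMSEQ_iff)
  thus "norm (lim d - d n) \<le> 2 * norm (d 0) * \<rho> n"
    by (rule tendsto_upperbound) (auto intro!: eventually_sequentiallyI[of n] tail')
qed

text \<open>
  Exchange of limits: approximations \<open>D\<^sub>n\<close> that are continuous in the parameter at \<open>p\<close> pass this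
  continuity on to \<open>\<Phi>\<close> when the error \<open>\<rho>\<^sub>n\<close> does not depend on the parameter or on the point.
\<close>
lemma uniform_limit_of_uniform_approximations:
  fixes \<Phi> :: "'p \<Rightarrow> 'x \<Rightarrow> 'm::metric_space"
  assumes approx: "\<And>n. uniform_limit X (D n) (D n p) G"
    and bound: "\<forall>\<^sub>F \<epsilon> in G. \<forall>x\<in>X. \<forall>n. dist (\<Phi> \<epsilon> x) (D n \<epsilon> x) \<le> \<rho> n"
    and bound0: "\<And>x n. x \<in> X \<Longrightarrow> dist (\<Phi> p x) (D n p x) \<le> \<rho> n"
    and lim: "\<rho> \<longlonglongrightarrow> (0::real)"
  shows "uniform_limit X \<Phi> (\<Phi> p) G"
proof (rule uniform_limitI)
  fix e :: real assume "e > 0"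
  hence "\<forall>\<^sub>F n in sequentially. \<rho> n < e / 3"
    using lim by (intro order_tendstoD) auto
  then obtain n where n: "\<rho> n < e / 3"
    by (auto simp: eventually_sequentially)
  have "\<forall>\<^sub>F \<epsilon> in G. \<forall>x\<in>X. dist (D n \<epsilon> x) (D n p x) < e / 3"
    using uniform_limitD[OF approx, of "e/3" n] \<open>e > 0\<close> by simp
  with bound show "\<forall>\<^sub>F \<epsilon> in G. \<forall>x\<in>X. dist (\<Phi> \<epsilon> x) (\<Phi> p x) < e"
  proof eventually_elim
    case (elim \<epsilon>)
    show ?case
    proof
      fix x assume "x \<in> X"
      have "dist (\<Phi> \<epsilon> x) (\<Phi> p x)
          \<le> dist (\<Phi> \<epsilon> x) (D n \<epsilon> x) + dist (D n \<epsilon> x) (D n p x) + dist (\<Phi> p x) (D n p x)"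
        by metric
      moreover have "dist (\<Phi> \<epsilon> x) (D n \<epsilon> x) \<le> \<rho> n" "dist (D n \<epsilon> x) (D n p x) < e / 3"
        using elim \<open>x \<in> X\<close> by auto
      moreover note bound0[OF \<open>x \<in> X\<close>, of n] n
      ultimately show "dist (\<Phi> \<epsilon> x) (\<Phi> p x) < e"
        by linarith
    qed
  qed
qed

section \<open>Exterior maps close to an affine map\<close>

text \<open>
  In the coordinate \<open>s = 1/z\<close> the map \<open>g\<close> extends over \<open>s = 0\<close> with value \<open>0\<close>, and Cauchy's
  inequality bounds its derivative on the disc \<open>|s| \<le> 1/(2M)\<close>. This disc is convex, so the bound is
  a Lipschitz constant there. Convexity is the gain: the exterior domain in the coordinate \<open>z\<close>
  is not convex. Any decay of \<open>g\<close> at infinity is thereby improved to the rate \<open>1/|z|\<close>.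
\<close>
lemma exterior_lipschitz:
  fixes g :: "complex \<Rightarrow> complex"
  assumes hol: "g holomorphic_on {z. M < norm z}" and M: "0 < M"
    and bound: "\<And>z. M < norm z \<Longrightarrow> norm (g z) \<le> C"
    and lim: "(g \<longlongrightarrow> 0) at_infinity"
    and zw: "2 * M \<le> norm z" "2 * M \<le> norm w"
  shows "norm (g z) \<le> 4 * M * C / norm z"
    and "norm (g z - g w) \<le> 4 * M * C * norm (z - w) / (norm z * norm w)"
proof -
  define G where "G = (\<lambda>s. if s = 0 then 0 else g (1 / s))"
  have inv_mem: "M < norm (1 / s)" if "s \<in> ball 0 (1 / M) - {0}" for s :: complex
    using that M by (auto simp: norm_divide field_simps)
  have "(\<lambda>s. g (1 / s)) holomorphic_on ball 0 (1 / M) - {0}"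
  proof (rule holomorphic_on_compose_gen[OF _ hol, unfolded o_def])
    show "(\<lambda>s. 1 / s) holomorphic_on ball 0 (1 / M) - {0::complex}"
      by (intro holomorphic_intros) auto
  qed (use inv_mem in auto)
  moreover have "(\<lambda>s. g (1 / s)) \<midarrow>0\<rightarrow> 0"
    using lim by (simp add: lim_at_infinity_0 o_def inverse_eq_divide)
  ultimately have holG: "G holomorphic_on ball 0 (1 / M)"
    unfolding G_def by (intro removable_singularity) auto
  have C: "0 \<le> C"
    using bound[of "of_real (M + 1)"] M norm_ge_zero[of "g (of_real (M + 1))"]
    by (simp del: norm_ge_zero of_real_add)
  have boundG: "norm (G s) \<le> C" if "s \<in> ball 0 (1 / M)" for s
    using bound[OF inv_mem[of s]] that C by (auto simp: G_def)
  have deriv_bound: "norm (deriv G s) \<le> 4 * M * C" if s: "s \<in> cball 0 (1 / (2 * M))" for s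
  proof -
    have sub: "cball s (1 / (4 * M)) \<subseteq> ball 0 (1 / M)"
    proof
      fix x assume "x \<in> cball s (1 / (4 * M))"
      hence "norm x \<le> 1 / (2 * M) + 1 / (4 * M)"
        using s norm_triangle_sub[of x s] by (simp add: dist_norm norm_minus_commute)
      also have "\<dots> < 1 / M" using M by (simp add: field_simps)
      finally show "x \<in> ball 0 (1 / M)" by simp
    qed
    have "norm ((deriv ^^ 1) G s) \<le> fact 1 * C / (1 / (4 * M)) ^ 1"
    proof (rule Cauchy_inequality)
      show "G holomorphic_on ball s (1 / (4 * M))"
        using holG sub ball_subset_cball holomorphic_on_subset by (metis subset_trans)
      show "continuous_on (cball s (1 / (4 * M))) G"
        using holG sub holomorphic_on_imp_continuous_on holomorphic_on_subset by blast
      show "norm (G x) \<le> C" if "norm (s - x) = 1 / (4 * M)" for x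
      proof (rule boundG)
        have "x \<in> cball s (1 / (4 * M))" using that by (simp add: dist_norm)
        thus "x \<in> ball 0 (1 / M)" using sub by blast
      qed
    qed (use M in auto)
    thus ?thesis by (simp add: field_simps)
  qed
  have lipG: "norm (G x - G y) \<le> 4 * M * C * norm (x - y)"
    if "x \<in> cball 0 (1 / (2 * M))" "y \<in> cball 0 (1 / (2 * M))" for x y
  proof (rule field_differentiable_bound[where S = "cball 0 (1 / (2 * M))"])
    fix s :: complex assume s: "s \<in> cball 0 (1 / (2 * M))"
    moreover have "1 / (2 * M) < 1 / M" using M by (simp add: field_simps)
    ultimately have "s \<in> ball 0 (1 / M)" by auto
    thus "(G has_field_derivative deriv G s) (at s within cball 0 (1 / (2 * M)))"
      using holG holomorphic_derivI[of G "ball 0 (1/M)" s] has_field_derivative_at_within by blast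
  qed (use that deriv_bound in auto)
  have mem: "1 / x \<in> cball 0 (1 / (2 * M))" "x \<noteq> 0" "G (1 / x) = g x" if "2 * M \<le> norm x" for x
  proof -
    have "x \<noteq> 0" using that M by auto
    moreover have "1 / norm x \<le> 1 / (2 * M)" using that M by (intro divide_left_mono mult_pos_pos) auto
    ultimately show "1 / x \<in> cball 0 (1 / (2 * M))" "x \<noteq> 0" "G (1 / x) = g x"
      by (auto simp: G_def norm_divide)
  qed
  show "norm (g z) \<le> 4 * M * C / norm z"
    using lipG[of "1 / z" 0] mem[OF zw(1)] M by (simp add: norm_divide G_def)
  have "norm (1 / z - 1 / w) = norm (z - w) / (norm z * norm w)"
    using mem[OF zw(1)] mem[OF zw(2)]
    by (simp add: diff_frac_eq norm_divide norm_mult norm_minus_commute)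
  thus "norm (g z - g w) \<le> 4 * M * C * norm (z - w) / (norm z * norm w)"
    using lipG[of "1 / z" "1 / w"] mem[OF zw(1)] mem[OF zw(2)] by simp
qed

text \<open>
  A closed form whose successive differences dominate \<open>L / (S + cn)\<^sup>2\<close>; it is obtained from
  \<open>1/x\<^sup>2 \<le> (1/(x - c) - 1/x)/c\<close> at \<open>x = S + cn\<close>.
\<close>
definition tail_bound :: "real \<Rightarrow> real \<Rightarrow> real \<Rightarrow> nat \<Rightarrow> real" where
  "tail_bound S c L n = L / (c * (S - c + c * real n))"

text \<open>
  One map together with a height \<open>h\<close> that forces orbits to escape linearly. Only differences of
  values of \<open>F\<close> are compared with the linear map \<open>z \<mapsto> tz\<close>, so the constant term of the affine
  model does not appear. The constants \<open>S\<close>, \<open>c\<close>, \<open>L\<close> are kept apart from the map because a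
  family shares them.
\<close>
locale near_affine =
  fixes F :: "complex \<Rightarrow> complex" and t :: complex and h :: "complex \<Rightarrow> real" and S c L :: real
  assumes norm_t: "1 \<le> norm t"
    and h_le_norm: "\<And>z. h z \<le> norm z"
    and c_pos: "0 < c" and c_less: "c < S" and L_nonneg: "0 \<le> L"
    and small: "tail_bound S c L 0 \<le> 1 / 4"
    and h_step: "\<And>z. S \<le> h z \<Longrightarrow> h z + c \<le> h (F z)"
    and increment: "\<And>z w. S \<le> norm z \<Longrightarrow> S \<le> norm w \<Longrightarrow>
      norm (F z - F w - t * (z - w)) \<le> L * norm (z - w) / (norm z * norm w)"
begin

definition scaled_diff :: "complex \<Rightarrow> nat \<Rightarrow> complex \<Rightarrow> complex" where
  "scaled_diff a n z = ((F ^^ n) z - (F ^^ n) a) / t ^ n"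

definition coord :: "complex \<Rightarrow> complex \<Rightarrow> complex" where
  "coord a z = lim (\<lambda>n. scaled_diff a n z)"

lemma t_nonzero: "t \<noteq> 0"
  using norm_t by auto

lemma h_orbit: "S \<le> h z \<Longrightarrow> S + c * real n \<le> h ((F ^^ n) z)"
proof (induction n)
  case (Suc n)
  moreover have "0 \<le> c * real n" using c_pos by simp
  ultimately have "S \<le> h ((F ^^ n) z)" by linarith
  with h_step[OF this] Suc show ?case by (simp add: algebra_simps)
qed simp

lemma h_orbit_ge: "S \<le> h z \<Longrightarrow> S \<le> h ((F ^^ n) z)"
  using h_orbit[of z n] c_pos by (smt (verit) mult_nonneg_nonneg of_nat_0_le_iff)

lemma norm_orbit: "S \<le> h z \<Longrightarrow> S + c * real n \<le> norm ((F ^^ n) z)"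
  using h_orbit h_le_norm order_trans by blast

lemma norm_orbit_ge: "S \<le> h z \<Longrightarrow> S \<le> norm ((F ^^ n) z)"
  using h_orbit_ge h_le_norm order_trans by blast

lemma tail_bound_nonneg: "0 \<le> tail_bound S c L n"
  unfolding tail_bound_def using c_pos c_less L_nonneg
  by (intro divide_nonneg_nonneg mult_nonneg_nonneg) auto

lemma tail_bound_diff: "L / (S + c * real n)\<^sup>2 \<le> tail_bound S c L n - tail_bound S c L (Suc n)"
proof -
  define x where "x = S + c * real n"
  have x: "c < x" using c_pos c_less add_less_le_mono[of c S 0 "c * real n"] by (simp add: x_def)
  have "tail_bound S c L n - tail_bound S c L (Suc n) = L / (c * (x - c)) - L / (c * x)"
    by (simp add: tail_bound_def x_def algebra_simps)
  also have "\<dots> = L / ((x - c) * x)"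
    using x c_pos by (simp add: divide_simps) (simp add: algebra_simps)
  also have "L / x\<^sup>2 \<le> \<dots>"
    unfolding power2_eq_square using x c_pos L_nonneg
    by (intro divide_left_mono mult_right_mono mult_pos_pos) auto
  finally show ?thesis by (simp add: x_def)
qed

lemma tail_bound_antimono: "tail_bound S c L (Suc n) \<le> tail_bound S c L n"
  using tail_bound_diff[of n] L_nonneg zero_le_power2[of "S + c * real n"]
  by (smt (verit) divide_nonneg_nonneg)

lemma tail_bound_tendsto: "tail_bound S c L \<longlonglongrightarrow> 0"
proof -
  have "filterlim (\<lambda>n. c * (S - c + c * real n)) at_top sequentially"
    using c_pos
    by (intro filterlim_tendsto_pos_mult_at_top[OF tendsto_const]
        filterlim_tendsto_add_at_top[OF tendsto_const] filterlim_real_sequentially)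
  with tendsto_const show ?thesis
    unfolding tail_bound_def by (rule real_tendsto_divide_at_top)
qed

text \<open>
  Dividing by \<open>t\<^sup>n\<close> removes the linear part of the recursion for \<open>F\<^sup>n(z) - F\<^sup>n(a)\<close>, and only the
  increment of the perturbation survives. It carries the factor \<open>1/(|F\<^sup>n(z)| |F\<^sup>n(a)|)\<close>, which
  decays quadratically along the escaping orbits.
\<close>
lemma scaled_diff_increment:
  assumes "S \<le> h z" "S \<le> h a"
  shows "norm (scaled_diff a (Suc n) z - scaled_diff a n z)
    \<le> (tail_bound S c L n - tail_bound S c L (Suc n)) * norm (scaled_diff a n z)"
proof -
  define x y where "x = (F ^^ n) z" and "y = (F ^^ n) a"
  define r where "r = S + c * real n"
  have r: "0 < r" using c_pos c_less by (simp add: r_def add_pos_nonneg)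
  have xy: "r \<le> norm x" "r \<le> norm y"
    using norm_orbit assms by (auto simp: x_def y_def r_def)
  have "scaled_diff a (Suc n) z - scaled_diff a n z = (F x - F y - t * (x - y)) / t ^ Suc n"
    using t_nonzero by (simp add: scaled_diff_def x_def y_def field_simps)
  hence "norm (scaled_diff a (Suc n) z - scaled_diff a n z)
      = norm (F x - F y - t * (x - y)) / norm t ^ Suc n"
    by (simp add: norm_divide norm_power norm_mult)
  also have "\<dots> \<le> (L * norm (x - y) / (norm x * norm y)) / norm t ^ Suc n"
    using norm_orbit_ge assms by (intro divide_right_mono increment) (auto simp: x_def y_def)
  also have "\<dots> \<le> (L * norm (x - y) / r\<^sup>2) / norm t ^ Suc n"
    using xy r L_nonneg unfolding power2_eq_square
    by (intro divide_right_mono divide_left_mono mult_mono mult_pos_pos) auto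
  also have "\<dots> \<le> (L * norm (x - y) / r\<^sup>2) / norm t ^ n"
    using norm_t L_nonneg t_nonzero
    by (intro divide_left_mono mult_pos_pos power_increasing zero_less_power) auto
  also have "\<dots> = L / r\<^sup>2 * norm (scaled_diff a n z)"
    by (simp add: scaled_diff_def x_def y_def norm_divide norm_power)
  also have "\<dots> \<le> (tail_bound S c L n - tail_bound S c L (Suc n)) * norm (scaled_diff a n z)"
    using tail_bound_diff[of n] by (intro mult_right_mono) (auto simp: r_def)
  finally show ?thesis .
qed

lemma scaled_diff_converges:
  assumes "S \<le> h z" "S \<le> h a"
  shows "(\<lambda>n. scaled_diff a n z) \<longlonglongrightarrow> coord a z"
    and "norm (coord a z - scaled_diff a n z) \<le> 2 * norm (z - a) * tail_bound S c L n"
proof -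
  note * = small_relative_increments[of "\<lambda>n. scaled_diff a n z" "tail_bound S c L",
      OF scaled_diff_increment[OF assms] tail_bound_antimono tail_bound_nonneg small
        tail_bound_tendsto]
  show "(\<lambda>n. scaled_diff a n z) \<longlonglongrightarrow> coord a z"
    unfolding coord_def using *(1) by (simp add: convergent_LIMSEQ_iff)
  show "norm (coord a z - scaled_diff a n z) \<le> 2 * norm (z - a) * tail_bound S c L n"
    using *(2)[of n] by (simp add: coord_def scaled_diff_def)
qed

text \<open>
  At \<open>n = 0\<close> the error estimate reads \<open>|\<phi>(z) - (z - a)| \<le> |z - a|/2\<close>.
\<close>
lemma coord_eq_0_iff:
  assumes "S \<le> h z" "S \<le> h a"
  shows "coord a z = 0 \<longleftrightarrow> z = a"
proof
  assume "coord a z = 0"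
  hence "norm (z - a) \<le> 2 * norm (z - a) * tail_bound S c L 0"
    using scaled_diff_converges(2)[OF assms, of 0] by (simp add: scaled_diff_def norm_minus_commute)
  also have "\<dots> \<le> 2 * norm (z - a) * (1 / 4)"
    using small by (intro mult_left_mono) auto
  finally show "z = a" by simp
next
  assume "z = a"
  thus "coord a z = 0" by (simp add: coord_def scaled_diff_def)
qed

text \<open>
  Before the limit, \<open>d\<^sub>n(F(z))\<close> and \<open>t d\<^sub>n\<^sub>+\<^sub>1(z)\<close> have the common numerator term \<open>F\<^sup>n\<^sup>+\<^sup>1(z)\<close>; what
  remains is \<open>d\<^sub>n(F(a))\<close>, which does not depend on \<open>z\<close>.
\<close>
lemma coord_step:
  assumes "S \<le> h z" "S \<le> h a"
  shows "coord a (F z) = t * coord a z + coord a (F a)"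
proof -
  have F: "S \<le> h (F z)" "S \<le> h (F a)"
    using h_step assms c_pos by (smt (verit))+
  have "scaled_diff a n (F z) = t * scaled_diff a (Suc n) z + scaled_diff a n (F a)" for n
    using t_nonzero by (simp add: scaled_diff_def funpow_swap1 field_simps)
  hence "(\<lambda>n. scaled_diff a n (F z)) \<longlonglongrightarrow> t * coord a z + coord a (F a)"
    using scaled_diff_converges(1) assms F by (auto intro!: tendsto_intros LIMSEQ_Suc)
  with scaled_diff_converges(1)[OF F(1) assms(2)] show ?thesis
    by (rule LIMSEQ_unique)
qed

text \<open>
  The height strictly increases along \<open>F\<close>, so \<open>a\<close> is not a fixed point.
\<close>
lemma coord_image_nonzero:
  assumes "S \<le> h a"
  shows "coord a (F a) \<noteq> 0"
  using coord_eq_0_iff[of "F a" a] h_step[OF assms] assms c_pos by force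

lemma linearization:
  assumes "S \<le> h z" "S \<le> h a"
  shows "coord a (F z) / coord a (F a) = t * (coord a z / coord a (F a)) + 1"
  using coord_step[OF assms] coord_image_nonzero[OF assms(2)] by (simp add: field_simps)

text \<open>
  The rate of convergence is proportional to \<open>|z - a|\<close>, which is bounded on closed discs, so the
  limit is locally uniform. The strict inequality in the domain makes it open.
\<close>
lemma holomorphic_coord:
  assumes hol: "F holomorphic_on {z. S < h z}" and op: "open {z. S < h z}" and a: "S \<le> h a"
  shows "coord a holomorphic_on {z. S < h z}"
proof (rule holomorphic_uniform_sequence[OF op])
  fix n
  have "(F ^^ n) holomorphic_on {z. S < h z}"
  proof (induction n)
    case (Suc n)
    have "(F ^^ n) ` {z. S < h z} \<subseteq> {z. S < h z}"
    proof (cases n)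
      case (Suc m)
      hence "S < S + c * real n" using c_pos by simp
      hence "S < h ((F ^^ n) z)" if "S < h z" for z
        using h_orbit[of z n] that by linarith
      thus ?thesis by blast
    qed auto
    with Suc hol show ?case
      unfolding funpow.simps by (intro holomorphic_on_compose_gen)
  qed (simp add: id_def)
  thus "scaled_diff a n holomorphic_on {z. S < h z}"
    unfolding scaled_diff_def using t_nonzero by (intro holomorphic_intros) auto
next
  fix x assume "x \<in> {z. S < h z}"
  then obtain r where r: "r > 0" "cball x r \<subseteq> {z. S < h z}"
    using op open_contains_cball by blast
  define C where "C = 2 * (norm (x - a) + r)"
  have "uniform_limit (cball x r) (scaled_diff a) (coord a) sequentially"
  proof (rule uniform_limitI)
    fix e :: real assume "e > 0"
    have "(\<lambda>n. C * tail_bound S c L n) \<longlonglongrightarrow> C * 0"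
      by (intro tendsto_intros tail_bound_tendsto)
    hence "\<forall>\<^sub>F n in sequentially. C * tail_bound S c L n < e"
      using \<open>e > 0\<close> by (intro order_tendstoD) auto
    thus "\<forall>\<^sub>F n in sequentially. \<forall>z\<in>cball x r. dist (scaled_diff a n z) (coord a z) < e"
    proof eventually_elim
      case (elim n)
      show ?case
      proof
        fix z assume z: "z \<in> cball x r"
        have "norm (z - a) \<le> norm (z - x) + norm (x - a)"
          using norm_triangle_ineq[of "z - x" "x - a"] by simp
        hence "2 * norm (z - a) \<le> C"
          using z by (simp add: C_def dist_norm norm_minus_commute)
        hence "2 * norm (z - a) * tail_bound S c L n \<le> C * tail_bound S c L n"
          by (intro mult_right_mono tail_bound_nonneg)
        moreover have "S \<le> h z" using z r(2) by force
        ultimately show "dist (scaled_diff a n z) (coord a z) < e"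
          using scaled_diff_converges(2)[OF _ a, of z n] elim
          by (simp add: dist_norm norm_minus_commute)
      qed
    qed
  qed
  with r show "\<exists>d>0. cball x d \<subseteq> {z. S < h z} \<and>
      uniform_limit (cball x d) (scaled_diff a) (coord a) sequentially"
    by blast
qed

lemma lipschitz:
  assumes "S \<le> norm z" "S \<le> norm w"
  shows "norm (F z - F w) \<le> (norm t + L / S\<^sup>2) * norm (z - w)"
proof -
  have S: "0 < S" using c_pos c_less by simp
  have "L * norm (z - w) / (norm z * norm w) \<le> L * norm (z - w) / S\<^sup>2"
    using assms S L_nonneg unfolding power2_eq_square
    by (intro divide_left_mono mult_mono mult_pos_pos) auto
  moreover have "norm (F z - F w) \<le> norm (F z - F w - t * (z - w)) + norm t * norm (z - w)"
    using norm_triangle_ineq[of "F z - F w - t * (z - w)" "t * (z - w)"] by (simp add: norm_mult)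
  ultimately show ?thesis
    using increment[OF assms] by (simp add: algebra_simps)
qed

lemma continuous_on_F: "continuous_on {z. S \<le> norm z} F"
proof (rule lipschitz_on_continuous_on)
  show "(norm t + L / S\<^sup>2)-lipschitz_on {z. S \<le> norm z} F"
    using L_nonneg by (intro lipschitz_onI) (auto simp: dist_norm intro!: lipschitz add_nonneg_nonneg)
qed

lemma continuous_on_iterate: "continuous_on {z. S \<le> h z} (F ^^ n)"
proof (induction n)
  case (Suc n)
  have "continuous_on {z. S \<le> h z} (\<lambda>z. F ((F ^^ n) z))"
    using norm_orbit_ge by (intro continuous_on_compose2[OF continuous_on_F Suc]) auto
  thus ?case by (simp add: o_def)
qed (simp add: id_def)

end

section \<open>Dependence on the parameter\<close>

text \<open>
  The maps, multipliers and heights vary with the parameter, but \<open>S\<close>, \<open>c\<close> and \<open>L\<close> are shared. The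
  tail bounds depend only on these constants, which makes the convergence of the scaled
  differences uniform in the parameter.
\<close>
locale near_affine_family =
  fixes F :: "'p::topological_space \<Rightarrow> complex \<Rightarrow> complex" and t :: "'p \<Rightarrow> complex"
    and h :: "'p \<Rightarrow> complex \<Rightarrow> real" and S c L :: real and A :: "'p set" and p :: 'p
  assumes near_affine: "\<And>\<epsilon>. \<epsilon> \<in> A \<Longrightarrow> near_affine (F \<epsilon>) (t \<epsilon>) (h \<epsilon>) S c L"
    and p_mem: "p \<in> A"
    and t_tendsto: "(t \<longlongrightarrow> t p) (at p within A)"
    and F_tendsto: "\<And>K. compact K \<Longrightarrow> K \<subseteq> {z. S \<le> norm z} \<Longrightarrow>
      uniform_limit K F (F p) (at p within A)"
begin

sublocale limit: near_affine "F p" "t p" "h p" S c L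
  by (rule near_affine[OF p_mem])

lemma eventually_mem: "\<forall>\<^sub>F \<epsilon> in at p within A. \<epsilon> \<in> A"
  by (simp add: eventually_at_topological) (use open_UNIV in blast)

text \<open>
  The induction step splits \<open>F\<^sub>\<epsilon>(x) - F\<^sub>p(y)\<close>, for the two \<open>n\<close>-th iterates \<open>x\<close> and \<open>y\<close>, at
  \<open>F\<^sub>\<epsilon>(y)\<close>. The first part is controlled by a Lipschitz constant of \<open>F\<^sub>\<epsilon>\<close> common to all \<open>\<epsilon>\<close> near
  \<open>p\<close>, the second by convergence on the compact image of \<open>K\<close> under the \<open>n\<close>-th iterate of \<open>F\<^sub>p\<close>.
  Comparing at \<open>y\<close> and not at \<open>x\<close> keeps this compact set independent of \<open>\<epsilon>\<close>.
\<close>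
lemma uniform_limit_iterate:
  assumes K: "compact K" and h: "\<And>\<epsilon> z. \<epsilon> \<in> A \<Longrightarrow> z \<in> K \<Longrightarrow> S \<le> h \<epsilon> z"
  shows "uniform_limit K (\<lambda>\<epsilon>. F \<epsilon> ^^ n) (F p ^^ n) (at p within A)"
proof (induction n)
  case 0
  show ?case by (auto intro!: uniform_limit_const simp: id_def)
next
  case (Suc n)
  define \<Lambda> where "\<Lambda> = norm (t p) + 1 + L / S\<^sup>2"
  have \<Lambda>: "0 < \<Lambda>" unfolding \<Lambda>_def using limit.L_nonneg
    by (intro add_pos_nonneg add_nonneg_pos divide_nonneg_nonneg) auto
  have "compact ((F p ^^ n) ` K)"
    using h[OF p_mem]
    by (intro compact_continuous_image K continuous_on_subset[OF limit.continuous_on_iterate]) auto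
  moreover have "(F p ^^ n) ` K \<subseteq> {z. S \<le> norm z}"
    using limit.norm_orbit_ge h[OF p_mem] by auto
  ultimately have lim: "uniform_limit ((F p ^^ n) ` K) F (F p) (at p within A)"
    by (rule F_tendsto)
  show ?case
  proof (rule uniform_limitI)
    fix e :: real assume e: "e > 0"
    have "\<forall>\<^sub>F \<epsilon> in at p within A. \<forall>z\<in>K. dist ((F \<epsilon> ^^ n) z) ((F p ^^ n) z) < e / (2 * \<Lambda>)"
      using uniform_limitD[OF Suc, of "e / (2 * \<Lambda>)"] e \<Lambda> by simp
    moreover have "\<forall>\<^sub>F \<epsilon> in at p within A. \<forall>x\<in>(F p ^^ n) ` K. dist (F \<epsilon> x) (F p x) < e / 2"
      using uniform_limitD[OF lim, of "e / 2"] e by simp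
    moreover have "\<forall>\<^sub>F \<epsilon> in at p within A. norm (t \<epsilon>) < norm (t p) + 1"
      using tendsto_norm[OF t_tendsto] by (rule order_tendstoD) simp
    ultimately show "\<forall>\<^sub>F \<epsilon> in at p within A.
        \<forall>z\<in>K. dist ((F \<epsilon> ^^ Suc n) z) ((F p ^^ Suc n) z) < e"
      using eventually_mem
    proof eventually_elim
      case (elim \<epsilon>)
      interpret \<epsilon>: near_affine "F \<epsilon>" "t \<epsilon>" "h \<epsilon>" S c L
        by (rule near_affine) (use elim in simp)
      show ?case
      proof
        fix z assume z: "z \<in> K"
        define x y where "x = (F \<epsilon> ^^ n) z" and "y = (F p ^^ n) z"
        have "norm (F \<epsilon> x - F \<epsilon> y) \<le> (norm (t \<epsilon>) + L / S\<^sup>2) * norm (x - y)"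
          using \<epsilon>.norm_orbit_ge limit.norm_orbit_ge h z elim p_mem
          by (intro \<epsilon>.lipschitz) (auto simp: x_def y_def)
        also have "\<dots> \<le> \<Lambda> * norm (x - y)"
          using elim by (intro mult_right_mono) (auto simp: \<Lambda>_def)
        also have "\<dots> < \<Lambda> * (e / (2 * \<Lambda>))"
          using elim z \<Lambda> by (intro mult_strict_left_mono) (auto simp: x_def y_def dist_norm)
        finally have "dist (F \<epsilon> x) (F \<epsilon> y) < e / 2"
          using \<Lambda> by (simp add: dist_norm)
        moreover have "dist (F \<epsilon> y) (F p y) < e / 2"
          using elim z by (auto simp: y_def)
        moreover have "dist (F \<epsilon> x) (F p y) \<le> dist (F \<epsilon> x) (F \<epsilon> y) + dist (F \<epsilon> y) (F p y)"
          by (rule dist_triangle)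
        ultimately show "dist ((F \<epsilon> ^^ Suc n) z) ((F p ^^ Suc n) z) < e"
          by (simp add: x_def y_def)
      qed
    qed
  qed
qed

abbreviation "diff_at \<equiv> \<lambda>\<epsilon>. near_affine.scaled_diff (F \<epsilon>) (t \<epsilon>)"
abbreviation "coord_at \<equiv> \<lambda>\<epsilon>. near_affine.coord (F \<epsilon>) (t \<epsilon>)"

lemma diff_at_eq: "\<epsilon> \<in> A \<Longrightarrow> diff_at \<epsilon> a n z = ((F \<epsilon> ^^ n) z - (F \<epsilon> ^^ n) a) / t \<epsilon> ^ n"
  using near_affine.scaled_diff_def[OF near_affine] by blast

lemma uniform_limit_scaled_diff:
  assumes X: "uniform_limit X P (P p) (at p within A)" and Y: "uniform_limit X Q (Q p) (at p within A)"
    and bd: "bounded (P p ` X)" "bounded (Q p ` X)"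
  shows "uniform_limit X (\<lambda>\<epsilon> z. (P \<epsilon> z - Q \<epsilon> z) / t \<epsilon> ^ n) (\<lambda>z. (P p z - Q p z) / t p ^ n) (at p within A)"
proof (rule uniform_lim_divide[where b = 1])
  show "uniform_limit X (\<lambda>\<epsilon> z. P \<epsilon> z - Q \<epsilon> z) (\<lambda>z. P p z - Q p z) (at p within A)"
    by (intro uniform_limit_intros X Y)
  have "((\<lambda>\<epsilon>. t \<epsilon> ^ n) \<longlongrightarrow> t p ^ n) (at p within A)"
    by (intro tendsto_intros t_tendsto)
  thus "uniform_limit X (\<lambda>\<epsilon> z. t \<epsilon> ^ n) (\<lambda>z. t p ^ n) (at p within A)"
    by (auto simp: uniform_limit_iff tendsto_iff elim!: eventually_mono)
  show "bounded ((\<lambda>z. P p z - Q p z) ` X)"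
    using bd by (rule bounded_minus_comp)
qed (use limit.norm_t in \<open>auto simp: norm_power one_le_power\<close>)

text \<open>
  The points \<open>P \<epsilon> z\<close> are allowed to move with the parameter, since the normalizing constant is
  the coordinate of the moving point \<open>F\<^sub>\<epsilon>(a)\<close>.
\<close>
lemma uniform_limit_coord_moving:
  assumes P: "\<And>n. uniform_limit X (\<lambda>\<epsilon> z. (F \<epsilon> ^^ n) (P \<epsilon> z)) (\<lambda>z. (F p ^^ n) (P p z)) (at p within A)"
    and bd: "\<And>n. bounded ((\<lambda>z. (F p ^^ n) (P p z)) ` X)"
    and h: "\<And>\<epsilon> z. \<epsilon> \<in> A \<Longrightarrow> z \<in> X \<Longrightarrow> S \<le> h \<epsilon> (P \<epsilon> z)"
    and a: "\<And>\<epsilon>. \<epsilon> \<in> A \<Longrightarrow> S \<le> h \<epsilon> a"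
  shows "uniform_limit X (\<lambda>\<epsilon> z. coord_at \<epsilon> a (P \<epsilon> z)) (\<lambda>z. coord_at p a (P p z)) (at p within A)"
proof -
  obtain r where r: "\<And>z. z \<in> X \<Longrightarrow> norm (P p z - a) \<le> r"
    using bd[of 0] by (auto simp: bounded_any_center[of _ a] dist_norm norm_minus_commute)
  have error: "dist (coord_at \<epsilon> a (P \<epsilon> z)) (diff_at \<epsilon> a n (P \<epsilon> z)) \<le> 2 * (r + 1) * tail_bound S c L n"
    if "\<epsilon> \<in> A" "z \<in> X" "norm (P \<epsilon> z - a) \<le> r + 1" for \<epsilon> z n
  proof -
    interpret \<epsilon>: near_affine "F \<epsilon>" "t \<epsilon>" "h \<epsilon>" S c L
      by (rule near_affine) fact
    have "2 * norm (P \<epsilon> z - a) * tail_bound S c L n \<le> 2 * (r + 1) * tail_bound S c L n"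
      using that by (intro mult_right_mono \<epsilon>.tail_bound_nonneg) auto
    thus ?thesis
      using \<epsilon>.scaled_diff_converges(2)[of "P \<epsilon> z" a n] h a that by (simp add: dist_norm)
  qed
  have a': "uniform_limit {a} (\<lambda>\<epsilon>. F \<epsilon> ^^ n) (F p ^^ n) (at p within A)" for n
    by (rule uniform_limit_iterate) (use a in auto)
  have approx: "uniform_limit X (\<lambda>\<epsilon> z. diff_at \<epsilon> a n (P \<epsilon> z)) (\<lambda>z. diff_at p a n (P p z)) (at p within A)"
    for n
  proof -
    have "uniform_limit X (\<lambda>\<epsilon> z. (F \<epsilon> ^^ n) a) (\<lambda>z. (F p ^^ n) a) (at p within A)"
      using a'[of n] by (auto simp: uniform_limit_iff elim!: eventually_mono)
    moreover have "bounded ((\<lambda>z. (F p ^^ n) a) ` X)"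
      by (rule bounded_subset[of "{(F p ^^ n) a}"]) auto
    ultimately have "uniform_limit X (\<lambda>\<epsilon> z. ((F \<epsilon> ^^ n) (P \<epsilon> z) - (F \<epsilon> ^^ n) a) / t \<epsilon> ^ n)
        (\<lambda>z. ((F p ^^ n) (P p z) - (F p ^^ n) a) / t p ^ n) (at p within A)"
      by (rule uniform_limit_scaled_diff[OF P _ bd])
    moreover have "\<forall>\<^sub>F \<epsilon> in at p within A. \<forall>z\<in>X.
        diff_at \<epsilon> a n (P \<epsilon> z) = ((F \<epsilon> ^^ n) (P \<epsilon> z) - (F \<epsilon> ^^ n) a) / t \<epsilon> ^ n"
      using eventually_mem by eventually_elim (simp add: diff_at_eq)
    ultimately show ?thesis
      by (subst uniform_limit_cong) (auto simp: diff_at_eq p_mem)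
  qed
  have "\<forall>\<^sub>F \<epsilon> in at p within A. \<forall>z\<in>X. dist (P \<epsilon> z) (P p z) < 1"
    using uniform_limitD[OF P[of 0], of 1] by simp
  with eventually_mem have near: "\<forall>\<^sub>F \<epsilon> in at p within A. \<epsilon> \<in> A \<and> (\<forall>z\<in>X. norm (P \<epsilon> z - a) \<le> r + 1)"
  proof eventually_elim
    case (elim \<epsilon>)
    have "norm (P \<epsilon> z - a) \<le> r + 1" if "z \<in> X" for z
      using r[OF that] elim(2) that norm_triangle_ineq[of "P \<epsilon> z - P p z" "P p z - a"]
      by (fastforce simp: dist_norm)
    with elim show ?case by blast
  qed
  \<comment> \<open>The factor \<open>r + 1\<close> replaces \<open>r\<close> because the moving points stay only within distance \<open>1\<close> of
    the limit points.\<close>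
  show ?thesis
  proof (rule uniform_limit_of_uniform_approximations
      [where \<Phi> = "\<lambda>\<epsilon> z. coord_at \<epsilon> a (P \<epsilon> z)" and D = "\<lambda>n \<epsilon> z. diff_at \<epsilon> a n (P \<epsilon> z)"
        and \<rho> = "\<lambda>n. 2 * (r + 1) * tail_bound S c L n"])
    show "(\<lambda>n. 2 * (r + 1) * tail_bound S c L n) \<longlonglongrightarrow> 0"
      using tendsto_mult[OF tendsto_const limit.tail_bound_tendsto, of "2 * (r + 1)"] by simp
    show "\<forall>\<^sub>F \<epsilon> in at p within A. \<forall>z\<in>X. \<forall>n.
        dist (coord_at \<epsilon> a (P \<epsilon> z)) (diff_at \<epsilon> a n (P \<epsilon> z)) \<le> 2 * (r + 1) * tail_bound S c L n"
      using near by eventually_elim (use error in auto)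
    show "dist (coord_at p a (P p z)) (diff_at p a n (P p z)) \<le> 2 * (r + 1) * tail_bound S c L n"
      if "z \<in> X" for z n
      using error[OF p_mem that, of n] r[OF that] by simp
  qed (rule approx)
qed

lemma uniform_limit_linearization:
  assumes K: "compact K" and h: "\<And>\<epsilon> z. \<epsilon> \<in> A \<Longrightarrow> z \<in> K \<Longrightarrow> S \<le> h \<epsilon> z"
    and a: "\<And>\<epsilon>. \<epsilon> \<in> A \<Longrightarrow> S \<le> h \<epsilon> a"
  shows "uniform_limit K (\<lambda>\<epsilon> z. coord_at \<epsilon> a z / coord_at \<epsilon> a (F \<epsilon> a))
    (\<lambda>z. coord_at p a z / coord_at p a (F p a)) (at p within A)"
proof (rule uniform_lim_divide)
  have bounded: "bounded ((F p ^^ n) ` K)" for n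
    using h[OF p_mem] by (intro compact_imp_bounded compact_continuous_image K
        continuous_on_subset[OF limit.continuous_on_iterate]) auto
  show "uniform_limit K (\<lambda>\<epsilon>. coord_at \<epsilon> a) (coord_at p a) (at p within A)"
    using uniform_limit_coord_moving[where X = K and P = "\<lambda>_ z. z" and a = a] uniform_limit_iterate[OF K h] bounded h a
    by simp
  have "uniform_limit {a} (\<lambda>\<epsilon>. F \<epsilon> ^^ Suc n) (F p ^^ Suc n) (at p within A)" for n
    by (rule uniform_limit_iterate) (use a in auto)
  moreover have "S \<le> h \<epsilon> (F \<epsilon> a)" if "\<epsilon> \<in> A" for \<epsilon>
    using near_affine.h_orbit_ge[OF near_affine[OF that] a[OF that], of 1] by simp
  ultimately have "uniform_limit {a} (\<lambda>\<epsilon> z. coord_at \<epsilon> a (F \<epsilon> z)) (\<lambda>z. coord_at p a (F p z)) (at p within A)"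
    using uniform_limit_coord_moving[where X = "{a}" and P = F and a = a] a by (simp add: funpow_swap1)
  thus "uniform_limit K (\<lambda>\<epsilon> z. coord_at \<epsilon> a (F \<epsilon> a)) (\<lambda>z. coord_at p a (F p a)) (at p within A)"
    by (auto simp: uniform_limit_iff elim!: eventually_mono)
  obtain r where r: "\<And>z. z \<in> K \<Longrightarrow> norm (z - a) \<le> r"
    using compact_imp_bounded[OF K]
    by (auto simp: bounded_any_center[of _ a] dist_norm norm_minus_commute)
  show "bounded (coord_at p a ` K)"
  proof (rule boundedI)
    fix w assume "w \<in> coord_at p a ` K"
    then obtain z where z: "z \<in> K" "w = coord_at p a z" by blast
    have "2 * norm (z - a) * tail_bound S c L 0 \<le> 2 * norm (z - a) * (1 / 4)"
      using limit.small by (intro mult_left_mono) auto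
    moreover have "norm w \<le> norm (w - (z - a)) + norm (z - a)"
      using norm_triangle_sub[of w "z - a"] by simp
    ultimately show "norm w \<le> 2 * r"
      using limit.scaled_diff_converges(2)[OF h[OF p_mem z(1)] a[OF p_mem], of 0] r[OF z(1)]
        norm_ge_zero[of "z - a"]
      unfolding z(2) limit.scaled_diff_def funpow_0 power_0 div_by_1 by linarith
  qed
  show "0 < norm (coord_at p a (F p a))"
    using limit.coord_image_nonzero a p_mem by simp
qed simp

end

section \<open>Geometry of the height functions\<close>

lemma bdd_above_N0:
  "bdd_above ((\<lambda>\<theta>. Re (exp (\<i> * of_real \<theta>) * z)) ` {\<theta>. \<bar>\<theta>\<bar> \<le> \<alpha>})"
proof (rule bdd_aboveI2)
  fix \<theta>
  show "Re (exp (\<i> * of_real \<theta>) * z) \<le> norm z"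
    using complex_Re_le_cmod[of "exp (\<i> * of_real \<theta>) * z"] by (simp add: norm_mult)
qed

lemma N_0_upper:
  assumes "\<bar>\<theta>\<bar> \<le> \<alpha>"
  shows "Re (exp (\<i> * of_real \<theta>) * z) \<le> N \<alpha> \<tau> 0 z"
  unfolding N_def using cSUP_upper[OF _ bdd_above_N0, of \<theta> \<alpha> z] assms by simp

lemma N_0_least:
  assumes "0 \<le> \<alpha>" "\<And>\<theta>. \<bar>\<theta>\<bar> \<le> \<alpha> \<Longrightarrow> Re (exp (\<i> * of_real \<theta>) * z) \<le> B"
  shows "N \<alpha> \<tau> 0 z \<le> B"
proof -
  have "0 \<in> {\<theta>. \<bar>\<theta>\<bar> \<le> \<alpha>}" using assms(1) by simp
  thus ?thesis
    unfolding N_def if_P[OF refl] using assms(2) by (intro cSUP_least) blast+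
qed

lemma N_diff_le:
  assumes "0 \<le> \<alpha>"
  shows "N \<alpha> \<tau> \<epsilon> z \<le> N \<alpha> \<tau> \<epsilon> w + norm (z - w)"
proof (cases "\<epsilon> = 0")
  case True
  have "Re (exp (\<i> * of_real \<theta>) * z) \<le> N \<alpha> \<tau> 0 w + norm (z - w)" if "\<bar>\<theta>\<bar> \<le> \<alpha>" for \<theta>
  proof -
    have "Re (exp (\<i> * of_real \<theta>) * (z - w)) \<le> norm (z - w)"
      using complex_Re_le_cmod[of "exp (\<i> * of_real \<theta>) * (z - w)"] by (simp add: norm_mult)
    moreover have "Re (exp (\<i> * of_real \<theta>) * z)
        = Re (exp (\<i> * of_real \<theta>) * w) + Re (exp (\<i> * of_real \<theta>) * (z - w))"
      by (simp add: algebra_simps)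
    ultimately show ?thesis
      using N_0_upper[OF that, of w \<tau>] by linarith
  qed
  thus ?thesis using N_0_least[OF assms] True by blast
next
  case False
  thus ?thesis
    using norm_triangle_ineq[of "z - w" "w - b \<tau> \<epsilon>"] by (simp add: N_def)
qed

lemma N_le_norm:
  assumes "0 \<le> \<alpha>"
  shows "N \<alpha> \<tau> \<epsilon> z \<le> norm z"
proof -
  have "N \<alpha> \<tau> \<epsilon> 0 \<le> 0"
    using N_0_least[OF assms, of 0 0 \<tau>] by (cases "\<epsilon> = 0") (auto simp: N_def)
  with N_diff_le[OF assms, of \<tau> \<epsilon> z 0] show ?thesis by simp
qed

text \<open>
  \<open>N_diff_le\<close>, used in both directions, makes the height \<open>1\<close>-Lipschitz.
\<close>
lemma open_N_greater:
  assumes "0 \<le> \<alpha>"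
  shows "open {z. R < N \<alpha> \<tau> \<epsilon> z}"
proof -
  have "1-lipschitz_on UNIV (N \<alpha> \<tau> \<epsilon>)"
  proof (rule lipschitz_onI)
    fix z w
    show "dist (N \<alpha> \<tau> \<epsilon> z) (N \<alpha> \<tau> \<epsilon> w) \<le> 1 * dist z w"
      using N_diff_le[OF assms, of \<tau> \<epsilon> z w] N_diff_le[OF assms, of \<tau> \<epsilon> w z]
      by (simp add: dist_norm norm_minus_commute abs_le_iff)
  qed simp
  hence "continuous_on UNIV (N \<alpha> \<tau> \<epsilon>)"
    by (rule lipschitz_on_continuous_on)
  thus ?thesis
    by (intro open_Collect_less continuous_on_const)
qed

lemma Re_ge_norm_cos:
  assumes "\<alpha> < pi / 2" "z \<noteq> 0 \<Longrightarrow> \<bar>Arg z\<bar> \<le> \<alpha>"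
  shows "norm z * cos \<alpha> \<le> Re z"
proof (cases "z = 0")
  case False
  have "cos \<alpha> \<le> cos \<bar>Arg z\<bar>"
    using assms False by (intro cos_monotone_0_pi_le) auto
  thus ?thesis
    using cos_Arg[OF False] False by (simp add: field_simps)
qed auto

text \<open>
  This supplies one base point of large height for all parameters at once. For \<open>\<epsilon> \<noteq> 0\<close>, with
  \<open>s = \<tau>\<^sub>\<epsilon> - 1\<close> and hence \<open>b\<^sub>\<epsilon> = -1/s\<close>, the distance \<open>|x - b\<^sub>\<epsilon>|\<close> is \<open>|1 + sx|/|s|\<close>, and the radial
  condition bounds \<open>Re(s)\<close> from below by \<open>|s| cos(\<alpha>)\<close>.
\<close>
lemma N_of_real:
  assumes \<alpha>: "0 \<le> \<alpha>" "\<alpha> < pi / 2" and x: "0 \<le> x"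
    and \<tau>: "\<epsilon> \<noteq> 0 \<Longrightarrow> \<tau> \<epsilon> \<noteq> 1" "\<tau> \<epsilon> \<noteq> 1 \<Longrightarrow> \<bar>Arg (\<tau> \<epsilon> - 1)\<bar> \<le> \<alpha>"
  shows "x * cos \<alpha> \<le> N \<alpha> \<tau> \<epsilon> (of_real x)"
proof (cases "\<epsilon> = 0")
  case True
  have "x * cos \<alpha> \<le> x" using x by (simp add: mult_left_le)
  with N_0_upper[of 0 \<alpha> "of_real x" \<tau>] \<alpha> True show ?thesis by simp
next
  case False
  define s where "s = \<tau> \<epsilon> - 1"
  have s: "s \<noteq> 0" using \<tau> False by (simp add: s_def)
  have b: "b \<tau> \<epsilon> = - (1 / s)"
    using s by (simp add: b_def s_def divide_simps)
  have "norm (of_real x - b \<tau> \<epsilon>) = norm (1 + s * of_real x) / norm s"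
    unfolding b using s by (simp add: norm_divide[symmetric] field_simps)
  moreover have "1 + norm s * cos \<alpha> * x \<le> norm (1 + s * of_real x)"
  proof -
    have "norm s * cos \<alpha> * x \<le> Re s * x"
      using Re_ge_norm_cos[of \<alpha> s] \<alpha> \<tau> x by (intro mult_right_mono) (auto simp: s_def)
    thus ?thesis
      using complex_Re_le_cmod[of "1 + s * of_real x"] by simp
  qed
  ultimately have "(1 + norm s * cos \<alpha> * x) / norm s \<le> norm (of_real x - b \<tau> \<epsilon>)"
    by (simp add: divide_right_mono)
  moreover have "norm (b \<tau> \<epsilon>) = 1 / norm s"
    unfolding b by (simp add: norm_divide)
  moreover have "(1 + norm s * cos \<alpha> * x) / norm s = 1 / norm s + x * cos \<alpha>"
    using s by (simp add: field_simps)
  ultimately show ?thesis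
    using False by (simp add: N_def)
qed

text \<open>
  For \<open>\<epsilon> \<noteq> 0\<close> the point \<open>b\<^sub>\<epsilon>\<close> is the fixed point of \<open>z \<mapsto> \<tau>\<^sub>\<epsilon>z + 1\<close>, so this map multiplies the
  distance to \<open>b\<^sub>\<epsilon>\<close> by \<open>|\<tau>\<^sub>\<epsilon>|\<close>. At nonnegative height the distance is at least
  \<open>|b\<^sub>\<epsilon>| = 1/|\<tau>\<^sub>\<epsilon> - 1|\<close>, and the gain is at least \<open>(|\<tau>\<^sub>\<epsilon>| - 1)/|\<tau>\<^sub>\<epsilon> - 1| \<ge> cos(\<alpha>)\<close>. For
  \<open>\<epsilon> = 0\<close> each half-plane function in the supremum gains \<open>cos(\<theta>) \<ge> cos(\<alpha>)\<close>.
\<close>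
lemma N_affine_step:
  assumes \<alpha>: "0 \<le> \<alpha>" "\<alpha> < pi / 2" and z: "0 \<le> N \<alpha> \<tau> \<epsilon> z"
    and \<tau>: "\<tau> \<epsilon> = 1 \<longleftrightarrow> \<epsilon> = 0" "\<tau> \<epsilon> \<noteq> 1 \<Longrightarrow> \<bar>Arg (\<tau> \<epsilon> - 1)\<bar> \<le> \<alpha>"
  shows "N \<alpha> \<tau> \<epsilon> z + cos \<alpha> \<le> N \<alpha> \<tau> \<epsilon> (\<tau> \<epsilon> * z + 1)"
proof (cases "\<epsilon> = 0")
  case True
  have "N \<alpha> \<tau> 0 z \<le> N \<alpha> \<tau> 0 (z + 1) - cos \<alpha>"
  proof (rule N_0_least[OF \<alpha>(1)])
    fix \<theta> assume \<theta>: "\<bar>\<theta>\<bar> \<le> \<alpha>"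
    have "cos \<alpha> \<le> cos \<bar>\<theta>\<bar>"
      using \<alpha> \<theta> by (intro cos_monotone_0_pi_le) auto
    hence "cos \<alpha> \<le> Re (exp (\<i> * of_real \<theta>))"
      by (simp add: Re_exp)
    thus "Re (exp (\<i> * of_real \<theta>) * z) \<le> N \<alpha> \<tau> 0 (z + 1) - cos \<alpha>"
      using N_0_upper[OF \<theta>, of "z + 1" \<tau>] by (simp add: algebra_simps)
  qed
  thus ?thesis using True \<tau> by simp
next
  case False
  define s where "s = \<tau> \<epsilon> - 1"
  have s: "s \<noteq> 0" using \<tau> False by (simp add: s_def)
  have b: "b \<tau> \<epsilon> = - (1 / s)"
    using s by (simp add: b_def s_def divide_simps)
  have "\<tau> \<epsilon> * z + 1 - b \<tau> \<epsilon> = \<tau> \<epsilon> * (z - b \<tau> \<epsilon>)"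
    unfolding b using s by (simp add: s_def field_simps)
  hence fixed_point: "norm (\<tau> \<epsilon> * z + 1 - b \<tau> \<epsilon>) = norm (\<tau> \<epsilon>) * norm (z - b \<tau> \<epsilon>)"
    by (simp add: norm_mult)
  have "norm s * cos \<alpha> \<le> Re s"
    using Re_ge_norm_cos[of \<alpha> s] \<alpha> \<tau> by (auto simp: s_def)
  hence growth: "norm s * cos \<alpha> \<le> norm (\<tau> \<epsilon>) - 1"
    using complex_Re_le_cmod[of "\<tau> \<epsilon>"] by (simp add: s_def)
  have "1 / norm s \<le> norm (z - b \<tau> \<epsilon>)"
    using z False by (simp add: N_def b norm_divide)
  hence "norm s * cos \<alpha> * (1 / norm s) \<le> (norm (\<tau> \<epsilon>) - 1) * norm (z - b \<tau> \<epsilon>)"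
    using growth \<alpha> by (intro mult_mono order_trans[OF _ growth] mult_nonneg_nonneg cos_ge_zero) auto
  thus ?thesis
    using fixed_point False s by (simp add: N_def algebra_simps)
qed

section \<open>Simultaneous linearization\<close>

theorem theorem2p1:
  fixes \<alpha> \<sigma> R0 :: real
    and \<tau> :: "real \<Rightarrow> complex"
    and f :: "real \<Rightarrow> complex \<Rightarrow> complex"
  assumes "0 \<le> \<alpha>" "\<alpha> < pi / 2"
    and "0 < \<sigma>" "\<sigma> \<le> 1"
    and "R0 > 0"
    and "continuous_on {0..1} \<tau>"
    and "\<And>\<epsilon>. \<epsilon> \<in> {0..1} \<Longrightarrow> norm (\<tau> \<epsilon>) \<ge> 1"
    and "\<And>\<epsilon>. \<epsilon> \<in> {0..1} \<Longrightarrow> \<tau> \<epsilon> = 1 \<longleftrightarrow> \<epsilon> = 0"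
    and "radially_tends_to_1 \<alpha> \<tau>"
    and "\<And>\<epsilon>. \<epsilon> \<in> {0..1} \<Longrightarrow> holomorphic_near (f \<epsilon>) (\<B> R0)"
    and "uniform_expansion \<sigma> \<tau> f"
    and "\<And>K. compact K \<Longrightarrow> K \<subseteq> \<B> R0 \<Longrightarrow> uniform_limit K f (f 0) (at 0 within {0..1})"
  shows "\<forall>\<^sub>F R in at_top. \<exists>u :: real \<Rightarrow> complex \<Rightarrow> complex.
    (\<forall>\<epsilon>\<in>{0..1}.
       holomorphic_near (u \<epsilon>) (\<V> \<alpha> \<tau> \<epsilon> R) \<and>
       (\<forall>z\<in>\<V> \<alpha> \<tau> \<epsilon> R. f \<epsilon> z \<in> \<V> \<alpha> \<tau> \<epsilon> R \<and> u \<epsilon> (f \<epsilon> z) = \<tau> \<epsilon> * u \<epsilon> z + 1)) \<and>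
    (\<forall>K. compact K \<and> (\<forall>\<epsilon>\<in>{0..1}. K \<subseteq> \<V> \<alpha> \<tau> \<epsilon> R) \<longrightarrow>
       uniform_limit K u (u 0) (at 0 within {0..1}))"
proof -
  have arg: "\<bar>Arg (\<tau> \<epsilon> - 1)\<bar> \<le> \<alpha>" if "\<epsilon> \<in> {0..1}" "\<tau> \<epsilon> \<noteq> 1" for \<epsilon>
    using assms(9) that by (auto simp: radially_tends_to_1_def)
  have cos_pos: "0 < cos \<alpha>"
    using assms(1,2) by (intro cos_gt_zero_pi) auto
  \<comment> \<open>Half of the height gained by the affine map is reserved for absorbing the perturbation.\<close>
  define c where "c = cos \<alpha> / 2"
  define g where "g = (\<lambda>\<epsilon> z. f \<epsilon> z - (\<tau> \<epsilon> * z + 1))"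

  obtain C where C: "C > 0" "\<forall>\<^sub>F (\<epsilon>, z) in principal {0..1} \<times>\<^sub>F at_infinity.
      norm (g \<epsilon> z) \<le> C * norm (of_real (1 / norm z powr \<sigma>) :: complex)"
    using assms(11) unfolding uniform_expansion_def g_def
    by (elim landau_o.bigE) (auto simp: case_prod_unfold)
  from C(2) obtain P Q where PQ: "\<forall>\<epsilon>\<in>{0..1}. P \<epsilon>" "eventually Q at_infinity"
      "\<forall>\<epsilon> z. P \<epsilon> \<longrightarrow> Q z \<longrightarrow> norm (g \<epsilon> z) \<le> C * norm (of_real (1 / norm z powr \<sigma>) :: complex)"
    unfolding eventually_prod_filter eventually_principal case_prod_conv by blast
  then obtain M0 where M0: "\<And>\<epsilon> z. \<epsilon> \<in> {0..1} \<Longrightarrow> M0 \<le> norm z \<Longrightarrow>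
      norm (g \<epsilon> z) \<le> C * (1 / norm z powr \<sigma>)"
    by (force simp: eventually_at_infinity norm_divide)
  define M where "M = max 1 (max M0 R0)"
  have M: "1 \<le> M" "M0 \<le> M" "R0 \<le> M"
    by (auto simp: M_def)
  define L where "L = 4 * M * C"
  have L: "0 < L" using M C by (simp add: L_def)

  have hol_f: "f \<epsilon> holomorphic_on {z. M < norm z}" if \<epsilon>: "\<epsilon> \<in> {0..1}" for \<epsilon>
  proof -
    obtain U k where "\<B> R0 \<subseteq> U" "k holomorphic_on U" "\<forall>z\<in>\<B> R0. k z = f \<epsilon> z"
      using assms(10)[OF \<epsilon>] by (auto simp: holomorphic_near_def)
    moreover have "{z. M < norm z} \<subseteq> \<B> R0" using M by (auto simp: \<B>_def)
    ultimately show ?thesis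
      by (metis holomorphic_on_subset holomorphic_transform subset_iff)
  qed

  have g_lip: "norm (g \<epsilon> z) \<le> L / norm z"
    "norm (g \<epsilon> z - g \<epsilon> w) \<le> L * norm (z - w) / (norm z * norm w)"
    if "\<epsilon> \<in> {0..1}" "2 * M \<le> norm z" "2 * M \<le> norm w" for \<epsilon> z w
  proof -
    have hol: "g \<epsilon> holomorphic_on {z. M < norm z}"
      unfolding g_def using hol_f[OF that(1)] by (intro holomorphic_intros)
    have bound: "norm (g \<epsilon> z) \<le> C" if "M < norm z" for z
    proof -
      have "1 \<le> norm z powr \<sigma>"
        using that M assms(3) by (intro ge_one_powr_ge_zero) auto
      hence "C * (1 / norm z powr \<sigma>) \<le> C * 1"
        using C(1) by (intro mult_left_mono) (auto simp: divide_le_eq_1)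
      thus ?thesis using M0[of \<epsilon> z] \<open>\<epsilon> \<in> {0..1}\<close> that M by simp
    qed
    have lim: "(g \<epsilon> \<longlongrightarrow> 0) at_infinity"
    proof (rule Lim_null_comparison)
      show "\<forall>\<^sub>F z in at_infinity. norm (g \<epsilon> z) \<le> C * (norm z powr (- \<sigma>))"
        unfolding eventually_at_infinity using M0[OF that(1)]
        by (intro exI[of _ M0]) (auto simp: powr_minus_divide)
      have "((\<lambda>z::complex. norm z powr (- \<sigma>)) \<longlongrightarrow> 0) at_infinity"
        using assms(3) by (intro tendsto_neg_powr filterlim_norm_at_top) auto
      thus "((\<lambda>z::complex. C * (norm z powr (- \<sigma>))) \<longlongrightarrow> 0) at_infinity"
        using tendsto_mult_right_zero by blast
    qed
    from exterior_lipschitz[OF hol _ bound lim that(2,3)] M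
    show "norm (g \<epsilon> z) \<le> L / norm z"
      "norm (g \<epsilon> z - g \<epsilon> w) \<le> L * norm (z - w) / (norm z * norm w)"
      by (auto simp: L_def)
  qed

  \<comment> \<open>In this order: the estimates on \<open>g\<close> apply, \<open>S - c\<close> is positive, the perturbation costs at
    most \<open>c\<close> of height, and the relative increments sum to at most \<open>1/4\<close>.\<close>
  obtain S where S: "2 * M \<le> S" "c < S" "L / c \<le> S" "4 * L / c + c \<le> S"
    using that[of "max (max (2 * M) (c + 1)) (max (L / c) (4 * L / c + c))"] by linarith
  have c: "0 < c" using cos_pos by (simp add: c_def)
  have tail: "tail_bound S c L 0 \<le> 1 / 4"
  proof -
    have "4 * L / c \<le> S - c" using S by simp
    hence "4 * L \<le> c * (S - c)"
      using c by (simp add: field_simps)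
    thus ?thesis using c S by (simp add: tail_bound_def field_simps)
  qed

  have near: "near_affine (f \<epsilon>) (\<tau> \<epsilon>) (N \<alpha> \<tau> \<epsilon>) S c L" if \<epsilon>: "\<epsilon> \<in> {0..1}" for \<epsilon>
  proof
    show "1 \<le> norm (\<tau> \<epsilon>)" using assms(7) \<epsilon> .
    show "N \<alpha> \<tau> \<epsilon> z \<le> norm z" for z by (rule N_le_norm) fact
    show "N \<alpha> \<tau> \<epsilon> z + c \<le> N \<alpha> \<tau> \<epsilon> (f \<epsilon> z)" if z: "S \<le> N \<alpha> \<tau> \<epsilon> z" for z
    proof -
      have Sz: "S \<le> norm z" using z N_le_norm[OF assms(1)] order_trans by blast
      have "norm (g \<epsilon> z) \<le> L / norm z"
        using g_lip(1)[OF \<epsilon>, of z z] Sz S by simp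
      also have "\<dots> \<le> L / (L / c)"
        using L Sz S c by (intro divide_left_mono mult_pos_pos) auto
      finally have "norm (g \<epsilon> z) \<le> c"
        using L by simp
      moreover have "N \<alpha> \<tau> \<epsilon> (\<tau> \<epsilon> * z + 1) \<le> N \<alpha> \<tau> \<epsilon> (f \<epsilon> z) + norm (g \<epsilon> z)"
        using N_diff_le[OF assms(1), of \<tau> \<epsilon> "\<tau> \<epsilon> * z + 1" "f \<epsilon> z"]
        by (simp add: g_def norm_minus_commute)
      moreover have "N \<alpha> \<tau> \<epsilon> z + cos \<alpha> \<le> N \<alpha> \<tau> \<epsilon> (\<tau> \<epsilon> * z + 1)"
        using z S M c by (intro N_affine_step assms(1,2,8) arg \<epsilon>) auto
      ultimately show ?thesis by (simp add: c_def)
    qed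
    show "norm (f \<epsilon> z - f \<epsilon> w - \<tau> \<epsilon> * (z - w)) \<le> L * norm (z - w) / (norm z * norm w)"
      if "S \<le> norm z" "S \<le> norm w" for z w
      using g_lip(2)[OF \<epsilon>, of z w] that S by (simp add: g_def algebra_simps)
  qed (use c S L tail in auto)

  interpret near_affine_family f \<tau> "N \<alpha> \<tau>" S c L "{0..1}" 0
  proof (rule near_affine_family.intro)
    show "(\<tau> \<longlongrightarrow> \<tau> 0) (at 0 within {0..1})"
      using assms(6) by (auto simp: continuous_on_def)
    show "uniform_limit K f (f 0) (at 0 within {0..1})"
      if "compact K" "K \<subseteq> {z. S \<le> norm z}" for K
      using that S M by (intro assms(12)) (auto simp: \<B>_def)
  qed (use near in auto)

  \<comment> \<open>Neither the base point \<open>a\<close> nor \<open>u\<close> depends on \<open>R\<close>: every \<open>R > S\<close> is served by the same family,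
    which is holomorphic on the open sets \<open>{N > S}\<close>.\<close>
  define a where "a = complex_of_real (S / cos \<alpha>)"
  have a: "S \<le> N \<alpha> \<tau> \<epsilon> a" if "\<epsilon> \<in> {0..1}" for \<epsilon>
    using N_of_real[of \<alpha> "S / cos \<alpha>" \<epsilon> \<tau>] assms(1,2) assms(8)[OF that] arg[OF that] cos_pos S M
    by (simp add: a_def)
  define u where "u = (\<lambda>\<epsilon> z. coord_at \<epsilon> a z / coord_at \<epsilon> a (f \<epsilon> a))"

  show ?thesis
    using eventually_gt_at_top[of S]
  proof eventually_elim
    case (elim R)
    show ?case
    proof (intro exI[of _ u] conjI ballI allI impI)
      fix \<epsilon> :: real assume \<epsilon>: "\<epsilon> \<in> {0..1}"
      interpret \<epsilon>: near_affine "f \<epsilon>" "\<tau> \<epsilon>" "N \<alpha> \<tau> \<epsilon>" S c L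
        by (rule near) fact
      have op: "open {z. S < N \<alpha> \<tau> \<epsilon> z}"
        by (rule open_N_greater) fact
      have "{z. S < N \<alpha> \<tau> \<epsilon> z} \<subseteq> {z. M < norm z}"
      proof
        fix z assume "z \<in> {z. S < N \<alpha> \<tau> \<epsilon> z}"
        thus "z \<in> {z. M < norm z}" using \<epsilon>.h_le_norm[of z] S M by simp
      qed
      hence "f \<epsilon> holomorphic_on {z. S < N \<alpha> \<tau> \<epsilon> z}"
        using hol_f[OF \<epsilon>] holomorphic_on_subset by blast
      hence "u \<epsilon> holomorphic_on {z. S < N \<alpha> \<tau> \<epsilon> z}"
        unfolding u_def using op a[OF \<epsilon>] \<epsilon>.coord_image_nonzero[OF a[OF \<epsilon>]]
        by (intro holomorphic_on_divide \<epsilon>.holomorphic_coord holomorphic_on_const) auto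
      thus "holomorphic_near (u \<epsilon>) (\<V> \<alpha> \<tau> \<epsilon> R)"
        unfolding holomorphic_near_def using op elim
        by (intro exI[of _ "{z. S < N \<alpha> \<tau> \<epsilon> z}"] exI[of _ "u \<epsilon>"]) (auto simp: \<V>_def)
      fix z assume z: "z \<in> \<V> \<alpha> \<tau> \<epsilon> R"
      hence zS: "S \<le> N \<alpha> \<tau> \<epsilon> z" using elim by (simp add: \<V>_def)
      show "f \<epsilon> z \<in> \<V> \<alpha> \<tau> \<epsilon> R"
        using z \<epsilon>.h_step[OF zS] c by (simp add: \<V>_def)
      show "u \<epsilon> (f \<epsilon> z) = \<tau> \<epsilon> * u \<epsilon> z + 1"
        unfolding u_def by (rule \<epsilon>.linearization[OF zS a[OF \<epsilon>]])
    next
      fix K assume K: "compact K \<and> (\<forall>\<epsilon>\<in>{0..1}. K \<subseteq> \<V> \<alpha> \<tau> \<epsilon> R)"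
      have "S \<le> N \<alpha> \<tau> \<epsilon> z" if "\<epsilon> \<in> {0..1}" "z \<in> K" for \<epsilon> z
        using K that elim by (force simp: \<V>_def)
      thus "uniform_limit K u (u 0) (at 0 within {0..1})"
        unfolding u_def using K a by (intro uniform_limit_linearization) auto
    qed
  qed
qed

end
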